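(* Let $m,n\in\mathbb{N}$ and let $A_1,\dots,A_n\subseteq\{1,\dots,m\}$. Consider the coverage function $f:2^{\{1,\dots,n\}}\to\mathbb{R}$, $f(S)=|\bigcup_{i\in S}A_i|$. Let $t=\max_{\ell=1,\dots,m}|\{k : \ell\in A_k\}|$, i.e. $t$ is the maximum number of the sets $A_k$ any element of $\{1,\dots,m\}$ belongs to, and suppose $t\ge2$. Then $f$ is $(t-2)$-sos-submodular.
   Context: The multilinear extension (MLE) of a set function $f:2^\Omega\to\mathbb{R}$, $\Omega=\{1,\dots,n\}$, is the unique multilinear polynomial $F\in\mathbb{R}[x_1,\dots,x_n]$ (every variable appears with power at most $1$ in every monomial) with $F(1_S)=f(S)$ for all $S\subseteq\Omega$, where $1_S\in\{0,1\}^n$ is the indicator vector of $S$. For an ideal $I$ of a real polynomial ring, a polynomial $p$ is $\tau$-sos modulo $I$ if there are finitely many polynomials $q_1,\dots,q_M$ in that ring, each of degree at most $\tau$, with $p-\sum_{r=1}^M q_r^2\in I$. For $i\ne j$, $x_{-i,j}$ denotes the variables $x_1,\dots,x_n$ with $x_i,x_j$ removed, and $I_2[x_{-i,j}]=\langle x_k^2-x_k : k\neq i,j\rangle\subseteq\mathbb{R}[x_{-i,j}]$. The set function $f$ with MLE $F$ is $\tau$-sos-submodular ($\tau\in\{0,1,2,\dots\}$) if for all $i\neq j$ the polynomial $-\frac{\partial^2F(x)}{\partial x_i\partial x_j}$ (which does not involve $x_i,x_j$) is $\tau$-sos modulo $I_2[x_{-i,j}]$. *)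

theory Defs
  imports Complex_Main "HOL-Library.Poly_Mapping" "HOL-Library.Indicator_Function"
begin

text \<open>
  Real polynomials in indeterminates \<open>x\<^sub>0, x\<^sub>1, x\<^sub>2, \<dots>\<close> form the monoid algebra over
  the finitely supported exponent vectors; the ring structure is the one of
  \<^theory>\<open>HOL-Library.Poly_Mapping\<close>. A ring such as \<open>\<real>[x\<^sub>1, \<dots>, x\<^sub>n]\<close> is the subset
  \<open>poly_ring {1..n}\<close> of this type.
\<close>

type_synonym monomial = "nat \<Rightarrow>\<^sub>0 nat"
type_synonym rpoly = "monomial \<Rightarrow>\<^sub>0 real"

definition var :: "nat \<Rightarrow> rpoly" where
  "var k = Poly_Mapping.single (Poly_Mapping.single k 1) 1"

definition vars :: "rpoly \<Rightarrow> nat set" where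
  "vars p = (\<Union>\<alpha>\<in>Poly_Mapping.keys p. Poly_Mapping.keys \<alpha>)"

definition poly_ring :: "nat set \<Rightarrow> rpoly set" where
  "poly_ring V = {p. vars p \<subseteq> V}"

definition monom_degree :: "monomial \<Rightarrow> nat" where
  "monom_degree \<alpha> = (\<Sum>k\<in>Poly_Mapping.keys \<alpha>. Poly_Mapping.lookup \<alpha> k)"

text \<open>Total degree; the zero polynomial gets degree \<open>0\<close>, so it has degree at most every \<open>\<tau>\<close>.\<close>

definition total_degree :: "rpoly \<Rightarrow> nat" where
  "total_degree p = Max (insert 0 (monom_degree ` Poly_Mapping.keys p))"

definition eval_monom :: "(nat \<Rightarrow> real) \<Rightarrow> monomial \<Rightarrow> real" where
  "eval_monom x \<alpha> = (\<Prod>k\<in>Poly_Mapping.keys \<alpha>. x k ^ Poly_Mapping.lookup \<alpha> k)"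

definition eval_poly :: "rpoly \<Rightarrow> (nat \<Rightarrow> real) \<Rightarrow> real" where
  "eval_poly p x = (\<Sum>\<alpha>\<in>Poly_Mapping.keys p. Poly_Mapping.lookup p \<alpha> * eval_monom x \<alpha>)"

text \<open>
  The formal partial derivative. If \<open>x\<^sub>i\<close> does not occur in \<open>\<alpha>\<close>, the truncated
  subtraction is harmless because the coefficient vanishes.
\<close>

definition partial_deriv :: "nat \<Rightarrow> rpoly \<Rightarrow> rpoly" where
  "partial_deriv i p =
     (\<Sum>\<alpha>\<in>Poly_Mapping.keys p.
        Poly_Mapping.single (\<alpha> - Poly_Mapping.single i 1)
          (real (Poly_Mapping.lookup \<alpha> i) * Poly_Mapping.lookup p \<alpha>))"

definition multilinear :: "rpoly \<Rightarrow> bool" where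
  "multilinear p \<longleftrightarrow> (\<forall>\<alpha>\<in>Poly_Mapping.keys p. \<forall>k. Poly_Mapping.lookup \<alpha> k \<le> 1)"

definition is_mle :: "nat \<Rightarrow> (nat set \<Rightarrow> real) \<Rightarrow> rpoly \<Rightarrow> bool" where
  "is_mle n f F \<longleftrightarrow>
     F \<in> poly_ring {1..n} \<and> multilinear F \<and>
     (\<forall>S\<subseteq>{1..n}. eval_poly F (indicator S) = f S)"

definition mle :: "nat \<Rightarrow> (nat set \<Rightarrow> real) \<Rightarrow> rpoly" where
  "mle n f = (THE F. is_mle n f F)"

text \<open>The ideal generated by \<open>G\<close> inside the polynomial ring in the variables \<open>V\<close>.\<close>

definition ideal_gen :: "nat set \<Rightarrow> rpoly set \<Rightarrow> rpoly set" where
  "ideal_gen V G =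
     {\<Sum>g\<in>T. h g * g | T h. finite T \<and> T \<subseteq> G \<and> (\<forall>g\<in>T. h g \<in> poly_ring V)}"

definition I2 :: "nat set \<Rightarrow> rpoly set" where
  "I2 V = ideal_gen V {(var k)\<^sup>2 - var k | k. k \<in> V}"

definition sos_mod :: "nat set \<Rightarrow> nat \<Rightarrow> rpoly set \<Rightarrow> rpoly \<Rightarrow> bool" where
  "sos_mod V \<tau> I p \<longleftrightarrow>
     (\<exists>(M::nat) q. (\<forall>r\<in>{1..M}. q r \<in> poly_ring V \<and> total_degree (q r) \<le> \<tau>) \<and>
            p - (\<Sum>r=1..M. (q r)\<^sup>2) \<in> I)"

definition sos_submodular :: "nat \<Rightarrow> nat \<Rightarrow> (nat set \<Rightarrow> real) \<Rightarrow> bool" where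
  "sos_submodular n \<tau> f \<longleftrightarrow>
     (\<forall>i\<in>{1..n}. \<forall>j\<in>{1..n}. i \<noteq> j \<longrightarrow>
        sos_mod ({1..n} - {i, j}) \<tau> (I2 ({1..n} - {i, j}))
          (- partial_deriv i (partial_deriv j (mle n f))))"

definition coverage :: "(nat \<Rightarrow> nat set) \<Rightarrow> nat set \<Rightarrow> real" where
  "coverage A S = real (card (\<Union>i\<in>S. A i))"

text \<open>The description in \<^const>\<open>mle\<close> is proper: the multilinear extension exists and is unique.\<close>

lemma eval_poly_superset:
  assumes "finite X" "Poly_Mapping.keys p \<subseteq> X"
  shows "eval_poly p x = (\<Sum>\<alpha>\<in>X. Poly_Mapping.lookup p \<alpha> * eval_monom x \<alpha>)"
  unfolding eval_poly_def
  by (rule sum.mono_neutral_left) (use assms in \<open>auto simp: in_keys_iff\<close>)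

lemma eval_poly_add: "eval_poly (p + q) x = eval_poly p x + eval_poly q x"
proof -
  let ?X = "Poly_Mapping.keys p \<union> Poly_Mapping.keys q"
  have "Poly_Mapping.keys (p + q) \<subseteq> ?X" by (rule keys_add)
  then show ?thesis
    by (simp add: eval_poly_superset[of ?X] lookup_add distrib_right sum.distrib)
qed

lemma eval_poly_diff: "eval_poly (p - q) x = eval_poly p x - eval_poly q x"
  using eval_poly_add[of "p - q" q x] by simp

lemma eval_poly_sum: "eval_poly (sum P X) x = (\<Sum>i\<in>X. eval_poly (P i) x)"
proof (induction X rule: infinite_finite_induct)
qed (simp_all add: eval_poly_add, simp_all add: eval_poly_def)

lemma eval_poly_single: "eval_poly (Poly_Mapping.single \<alpha> c) x = c * eval_monom x \<alpha>"
  by (simp add: eval_poly_superset[of "{\<alpha>}"])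

lemma eval_monom_indicator:
  "eval_monom (indicator S) \<alpha> = of_bool (Poly_Mapping.keys \<alpha> \<subseteq> S)"
proof (cases "Poly_Mapping.keys \<alpha> \<subseteq> S")
  case True
  then show ?thesis
    unfolding eval_monom_def by (auto intro!: prod.neutral simp: indicator_def)
next
  case False
  then obtain k where "k \<in> Poly_Mapping.keys \<alpha>" "k \<notin> S" by blast
  then show ?thesis
    using False unfolding eval_monom_def
    by (auto intro!: bexI[of _ k] simp: indicator_def in_keys_iff)
qed

lemma multilinear_zero_unique:
  assumes "F \<in> poly_ring V" and ml: "multilinear F"
    and zero: "\<And>S. S \<subseteq> V \<Longrightarrow> eval_poly F (indicator S) = 0"
  shows "F = 0"
proof (rule ccontr)
  assume "F \<noteq> 0"
  define P where "P \<alpha> \<longleftrightarrow> \<alpha> \<in> Poly_Mapping.keys F" for \<alpha>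
  from \<open>F \<noteq> 0\<close> have "\<exists>\<alpha>. P \<alpha>" by (metis P_def equals0I keys_eq_empty)
  then obtain \<alpha> where \<alpha>: "P \<alpha>"
    and min: "\<And>\<beta>. P \<beta> \<Longrightarrow> card (Poly_Mapping.keys \<alpha>) \<le> card (Poly_Mapping.keys \<beta>)"
    using ex_has_least_nat[of P _ "\<lambda>\<alpha>. card (Poly_Mapping.keys \<alpha>)"] by blast
  let ?S = "Poly_Mapping.keys \<alpha>"
  have "?S \<subseteq> V" using assms(1) \<alpha> by (auto simp: poly_ring_def vars_def P_def)
  have eq: "\<beta> = \<alpha>" if "P \<beta>" "Poly_Mapping.keys \<beta> \<subseteq> ?S" for \<beta>
  proof (rule poly_mapping_eqI)
    fix k
    have keys: "Poly_Mapping.keys \<beta> = ?S"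
      using that min by (simp add: card_seteq)
    have "Poly_Mapping.lookup \<beta> k \<le> 1" "Poly_Mapping.lookup \<alpha> k \<le> 1"
      using ml that(1) \<alpha> by (auto simp: multilinear_def P_def)
    moreover have "Poly_Mapping.lookup \<beta> k = 0 \<longleftrightarrow> Poly_Mapping.lookup \<alpha> k = 0"
      using keys by (metis in_keys_iff)
    ultimately show "Poly_Mapping.lookup \<beta> k = Poly_Mapping.lookup \<alpha> k" by linarith
  qed
  have "eval_poly F (indicator ?S) =
      (\<Sum>\<beta>\<in>Poly_Mapping.keys F. if \<beta> = \<alpha> then Poly_Mapping.lookup F \<alpha> else 0)"
    unfolding eval_poly_def eval_monom_indicator
    by (rule sum.cong) (use eq in \<open>auto simp: P_def\<close>)
  also have "\<dots> = Poly_Mapping.lookup F \<alpha>" using \<alpha> by (simp add: P_def)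
  finally show False using zero[OF \<open>?S \<subseteq> V\<close>] \<alpha> by (simp add: P_def in_keys_iff)
qed

lemma subset_sum_inversion:
  fixes f :: "nat set \<Rightarrow> real"
  assumes "finite V"
  shows "\<exists>c. \<forall>S\<subseteq>V. (\<Sum>T\<in>Pow S. c T) = f S"
  using assms
proof (induction V arbitrary: f rule: finite_induct)
  case empty
  then show ?case by (auto intro: exI[of _ f])
next
  case (insert v V)
  obtain c where c: "\<And>S. S \<subseteq> V \<Longrightarrow> (\<Sum>T\<in>Pow S. c T) = f S"
    using insert.IH[of f] by blast
  obtain d where d: "\<And>S. S \<subseteq> V \<Longrightarrow> (\<Sum>T\<in>Pow S. d T) = f (insert v S) - f S"
    using insert.IH[of "\<lambda>S. f (insert v S) - f S"] by blast
  define e where "e T = (if v \<in> T then d (T - {v}) else c T)" for T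
  have *: "(\<Sum>T\<in>Pow S. e T) = (\<Sum>T\<in>Pow S. c T)" if "v \<notin> S" for S
    by (rule sum.cong) (use that in \<open>auto simp: e_def\<close>)
  have "(\<Sum>T\<in>Pow S. e T) = f S" if "S \<subseteq> insert v V" for S
  proof (cases "v \<in> S")
    case False
    then show ?thesis using that c[of S] *[of S] by auto
  next
    case True
    define R where "R = S - {v}"
    have R: "R \<subseteq> V" "v \<notin> R" "S = insert v R" "finite R"
      using that True insert.hyps by (auto simp: R_def intro: finite_subset)
    have inj: "inj_on (insert v) (Pow R)" using R(2) by (auto simp: inj_on_def)
    have "(\<Sum>T\<in>Pow S. e T) = (\<Sum>T\<in>Pow R. e T) + (\<Sum>T\<in>insert v ` Pow R. e T)"
      unfolding R(3) Pow_insert by (rule sum.union_disjoint) (use R in auto)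
    also have "(\<Sum>T\<in>insert v ` Pow R. e T) = (\<Sum>T\<in>Pow R. e (insert v T))"
      using inj by (simp add: sum.reindex)
    also have "\<dots> = (\<Sum>T\<in>Pow R. d T)"
      by (rule sum.cong) (use R(2) in \<open>auto simp: e_def intro!: arg_cong[of _ _ d]\<close>)
    finally show ?thesis using *[OF R(2)] c[OF R(1)] d[OF R(1)] R(3) by simp
  qed
  then show ?case by blast
qed

lemma ex1_mle: "\<exists>!F. is_mle n f F"
proof (rule ex_ex1I)
  let ?V = "{1..n}"
  obtain c where c: "\<And>S. S \<subseteq> ?V \<Longrightarrow> (\<Sum>T\<in>Pow S. c T) = f S"
    using subset_sum_inversion[of ?V f] by auto
  define mon :: "nat set \<Rightarrow> monomial" where "mon T = (\<Sum>k\<in>T. Poly_Mapping.single k 1)" for T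
  define F where "F = (\<Sum>T\<in>Pow ?V. Poly_Mapping.single (mon T) (c T))"
  have lookup_mon: "Poly_Mapping.lookup (mon T) k = of_bool (k \<in> T)" if "T \<subseteq> ?V" for T k
    using finite_subset[OF that] by (simp add: mon_def lookup_sum lookup_single when_def)
  have keys_mon: "Poly_Mapping.keys (mon T) = T" if "T \<subseteq> ?V" for T
    using lookup_mon[OF that] by (auto simp: in_keys_iff)
  have keys_F: "Poly_Mapping.keys F \<subseteq> mon ` Pow ?V"
  proof -
    have "Poly_Mapping.keys F \<subseteq> (\<Union>T\<in>Pow ?V. Poly_Mapping.keys (Poly_Mapping.single (mon T) (c T)))"
      unfolding F_def by (rule keys_sum)
    also have "\<dots> \<subseteq> mon ` Pow ?V" by (auto split: if_splits)
    finally show ?thesis .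
  qed
  have mono: "\<exists>T\<subseteq>?V. \<alpha> = mon T" if "\<alpha> \<in> Poly_Mapping.keys F" for \<alpha>
    using keys_F that by blast
  have "F \<in> poly_ring ?V"
    unfolding poly_ring_def vars_def using mono keys_mon by blast
  moreover have "multilinear F"
    unfolding multilinear_def
  proof (intro ballI allI)
    fix \<alpha> k assume "\<alpha> \<in> Poly_Mapping.keys F"
    then obtain T where "T \<subseteq> ?V" "\<alpha> = mon T" using mono by blast
    then show "Poly_Mapping.lookup \<alpha> k \<le> 1" using lookup_mon[of T k] by simp
  qed
  moreover have "eval_poly F (indicator S) = f S" if "S \<subseteq> ?V" for S
  proof -
    have "eval_poly F (indicator S) = (\<Sum>T\<in>Pow ?V. c T * of_bool (T \<subseteq> S))"
      unfolding F_def eval_poly_sum eval_poly_single eval_monom_indicator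
      by (rule sum.cong) (auto simp: keys_mon)
    also have "\<dots> = (\<Sum>T\<in>Pow S. c T)"
      by (rule sum.mono_neutral_cong_right) (use that in auto)
    finally show ?thesis using c[OF that] by simp
  qed
  ultimately show "\<exists>F. is_mle n f F" unfolding is_mle_def by blast
next
  fix F G assume FG: "is_mle n f F" "is_mle n f G"
  have keys: "Poly_Mapping.keys (F - G) \<subseteq> Poly_Mapping.keys F \<union> Poly_Mapping.keys G"
    by (rule keys_diff)
  have "F - G = 0"
  proof (rule multilinear_zero_unique)
    have "vars (F - G) \<subseteq> vars F \<union> vars G" using keys by (auto simp: vars_def)
    moreover have "vars F \<subseteq> {1..n}" "vars G \<subseteq> {1..n}"
      using FG unfolding is_mle_def poly_ring_def by simp_all
    ultimately have "vars (F - G) \<subseteq> {1..n}" by (meson Un_least subset_trans)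
    then show "F - G \<in> poly_ring {1..n}" by (simp add: poly_ring_def)
    show "multilinear (F - G)"
      unfolding multilinear_def
    proof
      fix \<alpha> assume "\<alpha> \<in> Poly_Mapping.keys (F - G)"
      then have "\<alpha> \<in> Poly_Mapping.keys F \<or> \<alpha> \<in> Poly_Mapping.keys G" using keys by blast
      moreover have "multilinear F" "multilinear G" using FG by (simp_all add: is_mle_def)
      ultimately show "\<forall>k. Poly_Mapping.lookup \<alpha> k \<le> 1" by (auto simp: multilinear_def)
    qed
    show "eval_poly (F - G) (indicator S) = 0" if "S \<subseteq> {1..n}" for S
      using FG that by (simp add: is_mle_def eval_poly_diff)
  qed
  then show "F = G" by simp
qed

lemma is_mle_mle: "is_mle n f (mle n f)"
  unfolding mle_def by (rule theI') (rule ex1_mle)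

end

theory Submission
  imports Defs
begin

text \<open>
  Call \<open>avoid K = (\<Prod>k\<in>K. 1 - x\<^sub>k)\<close> the avoidance polynomial of \<open>K\<close>: on the cube it is the
  indicator of the sets \<open>S\<close> that are disjoint from \<open>K\<close>. Counting \<open>\<Union>i\<in>S. A i\<close> element by
  element, an element \<open>l\<close> contributes \<open>1\<close> exactly when \<open>S\<close> meets \<open>K\<^sub>l = {k. l \<in> A k}\<close>. Hence the
  multilinear extension is \<open>\<Sum>l. 1 - avoid K\<^sub>l\<close> (lemma \<open>mle_coverage\<close>).

  Differentiating such a product in one of its variables deletes the corresponding factor and
  changes the sign, and a product in which the variable does not occur is killed. So minus the
  mixed second derivative in \<open>x\<^sub>i, x\<^sub>j\<close> is the sum of \<open>avoid (K\<^sub>l - {i, j})\<close> over those \<open>l\<close> with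
  \<open>i, j \<in> K\<^sub>l\<close>. Since \<open>avoid K\<close> takes only the values \<open>0\<close> and \<open>1\<close> on the cube, it is idempotent
  modulo the ideal of the cube (lemma \<open>avoid_idempotent_mod_I2\<close>): each summand is congruent to
  its own square. Its degree is at most \<open>card K\<^sub>l - 2 \<le> t - 2\<close>, so the summands themselves
  are the required sum-of-squares certificate.
\<close>

section \<open>Polynomials as sums of monomials\<close>

lemma poly_eq_sum_monomials:
  "(p :: rpoly) =
     (\<Sum>\<alpha>\<in>Poly_Mapping.keys p. Poly_Mapping.single \<alpha> (Poly_Mapping.lookup p \<alpha>))"
  by (rule poly_mapping_eqI) (simp add: lookup_sum lookup_single when_def in_keys_iff)

lemma var_mult_eq_sum_monomials:
  "var k * p = (\<Sum>\<alpha>\<in>Poly_Mapping.keys p.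
     Poly_Mapping.single (Poly_Mapping.single k 1 + \<alpha>) (Poly_Mapping.lookup p \<alpha>))"
proof -
  have "var k * p =
      var k * (\<Sum>\<alpha>\<in>Poly_Mapping.keys p. Poly_Mapping.single \<alpha> (Poly_Mapping.lookup p \<alpha>))"
    using poly_eq_sum_monomials[of p] by simp
  then show ?thesis
    by (simp add: sum_distrib_left var_def mult_single)
qed

lemma keys_var_mult_subset:
  "Poly_Mapping.keys (var k * p) \<subseteq> (\<lambda>\<alpha>. Poly_Mapping.single k 1 + \<alpha>) ` Poly_Mapping.keys p"
  using keys_mult[of "var k" p] by (auto simp: var_def)

lemma vars_add: "vars (p + q) \<subseteq> vars p \<union> vars q"
  using keys_add[of p q] by (auto simp: vars_def)

lemma vars_diff: "vars (p - q) \<subseteq> vars p \<union> vars q"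
  using keys_diff[of p q] by (auto simp: vars_def)

lemma vars_mult: "vars (p * q) \<subseteq> vars p \<union> vars q"
proof
  fix k assume "k \<in> vars (p * q)"
  then obtain \<alpha> where \<alpha>: "\<alpha> \<in> Poly_Mapping.keys (p * q)" "k \<in> Poly_Mapping.keys \<alpha>"
    by (auto simp: vars_def)
  then obtain a b where "\<alpha> = a + b" "a \<in> Poly_Mapping.keys p" "b \<in> Poly_Mapping.keys q"
    using keys_mult[of p q] by blast
  then show "k \<in> vars p \<union> vars q"
    using \<alpha>(2) keys_add[of a b] by (auto simp: vars_def)
qed

lemma vars_sum: "vars (sum P X) \<subseteq> (\<Union>i\<in>X. vars (P i))"
  using keys_sum[of P X] unfolding vars_def by blast

lemma vars_one [simp]: "vars 1 = {}"
  by (simp add: vars_def)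

lemma vars_var [simp]: "vars (var k) = {k}"
  by (simp add: vars_def var_def)

lemma poly_ring_0 [simp]: "0 \<in> poly_ring V"
  by (simp add: poly_ring_def vars_def)

lemma poly_ring_add: "p \<in> poly_ring V \<Longrightarrow> q \<in> poly_ring V \<Longrightarrow> p + q \<in> poly_ring V"
  using vars_add[of p q] by (auto simp: poly_ring_def)

lemma poly_ring_mult: "p \<in> poly_ring V \<Longrightarrow> q \<in> poly_ring V \<Longrightarrow> p * q \<in> poly_ring V"
  using vars_mult[of p q] by (auto simp: poly_ring_def)

section \<open>Degree, multilinearity and evaluation\<close>

lemma monom_degree_add: "monom_degree (\<alpha> + \<beta>) = monom_degree \<alpha> + monom_degree \<beta>"
proof -
  let ?X = "Poly_Mapping.keys \<alpha> \<union> Poly_Mapping.keys \<beta>"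
  have ext: "monom_degree \<gamma> = (\<Sum>k\<in>?X. Poly_Mapping.lookup \<gamma> k)"
    if "Poly_Mapping.keys \<gamma> \<subseteq> ?X" for \<gamma>
    unfolding monom_degree_def
    by (rule sum.mono_neutral_left) (use that in \<open>auto simp: in_keys_iff\<close>)
  show ?thesis
    using ext[of "\<alpha> + \<beta>"] ext[of \<alpha>] ext[of \<beta>] keys_add[of \<alpha> \<beta>]
    by (simp add: lookup_add sum.distrib)
qed

lemma total_degree_le_iff:
  "total_degree p \<le> d \<longleftrightarrow> (\<forall>\<alpha>\<in>Poly_Mapping.keys p. monom_degree \<alpha> \<le> d)"
  by (simp add: total_degree_def)

lemma total_degree_mult_le:
  assumes "total_degree p \<le> a" "total_degree q \<le> b"
  shows "total_degree (p * q) \<le> a + b"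
  unfolding total_degree_le_iff
proof
  fix \<gamma> assume "\<gamma> \<in> Poly_Mapping.keys (p * q)"
  then obtain \<alpha> \<beta> where "\<gamma> = \<alpha> + \<beta>" "\<alpha> \<in> Poly_Mapping.keys p" "\<beta> \<in> Poly_Mapping.keys q"
    using keys_mult[of p q] by blast
  then show "monom_degree \<gamma> \<le> a + b"
    using assms by (simp add: total_degree_le_iff monom_degree_add add_mono)
qed

lemma multilinear_diff:
  assumes "multilinear p" "multilinear q"
  shows "multilinear (p - q)"
  using assms keys_diff[of p q] unfolding multilinear_def by blast

lemma multilinear_sum:
  assumes "\<And>i. i \<in> X \<Longrightarrow> multilinear (P i)"
  shows "multilinear (sum P X)"
  using assms keys_sum[of P X] unfolding multilinear_def by blast

lemma multilinear_one: "multilinear 1"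
  by (simp add: multilinear_def)

lemma multilinear_var_mult:
  assumes "multilinear p" "k \<notin> vars p"
  shows "multilinear (var k * p)"
  unfolding multilinear_def
proof (intro ballI allI)
  fix \<beta> l assume "\<beta> \<in> Poly_Mapping.keys (var k * p)"
  then obtain \<alpha> where \<alpha>: "\<beta> = Poly_Mapping.single k 1 + \<alpha>" "\<alpha> \<in> Poly_Mapping.keys p"
    using keys_var_mult_subset by blast
  have "Poly_Mapping.lookup \<alpha> l \<le> 1" "Poly_Mapping.lookup \<alpha> k = 0"
    using assms \<alpha>(2) by (auto simp: multilinear_def vars_def in_keys_iff)
  then show "Poly_Mapping.lookup \<beta> l \<le> 1"
    by (auto simp: \<alpha>(1) lookup_add lookup_single when_def)
qed

lemma eval_monom_add: "eval_monom x (\<alpha> + \<beta>) = eval_monom x \<alpha> * eval_monom x \<beta>"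
proof -
  let ?X = "Poly_Mapping.keys \<alpha> \<union> Poly_Mapping.keys \<beta>"
  have ext: "eval_monom x \<gamma> = (\<Prod>k\<in>?X. x k ^ Poly_Mapping.lookup \<gamma> k)"
    if "Poly_Mapping.keys \<gamma> \<subseteq> ?X" for \<gamma>
    unfolding eval_monom_def
    by (rule prod.mono_neutral_left) (use that in \<open>auto simp: in_keys_iff\<close>)
  show ?thesis
    using ext[of "\<alpha> + \<beta>"] ext[of \<alpha>] ext[of \<beta>] keys_add[of \<alpha> \<beta>]
    by (simp add: lookup_add power_add prod.distrib)
qed

lemma eval_poly_one [simp]: "eval_poly 1 x = 1"
  by (simp add: eval_poly_def eval_monom_def)

lemma eval_poly_var_mult: "eval_poly (var k * p) x = x k * eval_poly p x"
proof -
  have "eval_monom x (Poly_Mapping.single k 1) = x k"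
    by (simp add: eval_monom_def)
  then show ?thesis
    by (simp add: var_mult_eq_sum_monomials eval_poly_sum eval_poly_single eval_monom_add
        eval_poly_def[of p] sum_distrib_left mult.left_commute)
qed

section \<open>Partial derivatives\<close>

lemma partial_deriv_superset:
  assumes "finite X" "Poly_Mapping.keys p \<subseteq> X"
  shows "partial_deriv i p =
    (\<Sum>\<alpha>\<in>X. Poly_Mapping.single (\<alpha> - Poly_Mapping.single i 1)
                (real (Poly_Mapping.lookup \<alpha> i) * Poly_Mapping.lookup p \<alpha>))"
  unfolding partial_deriv_def
  by (rule sum.mono_neutral_left) (use assms in \<open>auto simp: in_keys_iff\<close>)

lemma partial_deriv_single:
  "partial_deriv i (Poly_Mapping.single \<alpha> c) =
     Poly_Mapping.single (\<alpha> - Poly_Mapping.single i 1) (real (Poly_Mapping.lookup \<alpha> i) * c)"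
  by (simp add: partial_deriv_superset[of "{\<alpha>}"])

lemma partial_deriv_add: "partial_deriv i (p + q) = partial_deriv i p + partial_deriv i q"
proof -
  let ?X = "Poly_Mapping.keys p \<union> Poly_Mapping.keys q"
  have "Poly_Mapping.keys (p + q) \<subseteq> ?X" by (rule keys_add)
  then show ?thesis
    by (simp add: partial_deriv_superset[of ?X] lookup_add distrib_left single_add sum.distrib)
qed

lemma partial_deriv_diff: "partial_deriv i (p - q) = partial_deriv i p - partial_deriv i q"
  using partial_deriv_add[of i "p - q" q] by simp

lemma partial_deriv_zero [simp]: "partial_deriv i 0 = 0"
  by (simp add: partial_deriv_def)

lemma partial_deriv_sum: "partial_deriv i (sum P X) = (\<Sum>l\<in>X. partial_deriv i (P l))"
  by (induction X rule: infinite_finite_induct) (simp_all add: partial_deriv_add)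

lemma partial_deriv_notin_vars:
  assumes "i \<notin> vars p"
  shows "partial_deriv i p = 0"
  unfolding partial_deriv_def
  by (rule sum.neutral) (use assms in \<open>auto simp: vars_def in_keys_iff\<close>)

lemma partial_deriv_var_mult:
  assumes "i \<notin> vars p"
  shows "partial_deriv i (var i * p) = p"
proof -
  have "partial_deriv i (var i * p) =
      (\<Sum>\<alpha>\<in>Poly_Mapping.keys p. Poly_Mapping.single \<alpha> (Poly_Mapping.lookup p \<alpha>))"
    unfolding var_mult_eq_sum_monomials partial_deriv_sum partial_deriv_single
    by (rule sum.cong) (use assms in \<open>auto simp: vars_def in_keys_iff lookup_add\<close>)
  then show ?thesis using poly_eq_sum_monomials[of p] by simp
qed

section \<open>The ideal of the cube\<close>

lemma ideal_gen_zero: "0 \<in> ideal_gen V G"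
  unfolding ideal_gen_def by (auto intro!: exI[of _ "{}"])

lemma ideal_gen_mult_generator:
  assumes "g \<in> G" "p \<in> poly_ring V"
  shows "p * g \<in> ideal_gen V G"
  unfolding ideal_gen_def using assms by (auto intro!: exI[of _ "{g}"] exI[of _ "\<lambda>_. p"])

lemma ideal_gen_add:
  assumes "a \<in> ideal_gen V G" "b \<in> ideal_gen V G"
  shows "a + b \<in> ideal_gen V G"
proof -
  obtain T h where T: "a = (\<Sum>g\<in>T. h g * g)" "finite T" "T \<subseteq> G" "\<forall>g\<in>T. h g \<in> poly_ring V"
    using assms(1) by (auto simp: ideal_gen_def)
  obtain U k where U: "b = (\<Sum>g\<in>U. k g * g)" "finite U" "U \<subseteq> G" "\<forall>g\<in>U. k g \<in> poly_ring V"
    using assms(2) by (auto simp: ideal_gen_def)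
  \<comment> \<open>Extending both cofactor families by \<open>0\<close> lets them share the generators \<open>T \<union> U\<close>.\<close>
  define h' where "h' g = (if g \<in> T then h g else 0)" for g
  define k' where "k' g = (if g \<in> U then k g else 0)" for g
  have "a = (\<Sum>g\<in>T \<union> U. h' g * g)"
    unfolding T(1) by (rule sum.mono_neutral_cong_left) (use T U in \<open>auto simp: h'_def\<close>)
  moreover have "b = (\<Sum>g\<in>T \<union> U. k' g * g)"
    unfolding U(1) by (rule sum.mono_neutral_cong_left) (use T U in \<open>auto simp: k'_def\<close>)
  ultimately have "a + b = (\<Sum>g\<in>T \<union> U. (h' g + k' g) * g)"
    by (simp add: sum.distrib distrib_right)
  moreover have "\<forall>g\<in>T \<union> U. h' g + k' g \<in> poly_ring V"
    using T(4) U(4) by (auto simp: h'_def k'_def intro!: poly_ring_add)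
  ultimately show ?thesis
    unfolding ideal_gen_def mem_Collect_eq
    by (intro exI[of _ "T \<union> U"] exI[of _ "\<lambda>g. h' g + k' g"]) (use T U in auto)
qed

lemma ideal_gen_sum:
  assumes "\<And>l. l \<in> X \<Longrightarrow> P l \<in> ideal_gen V G"
  shows "sum P X \<in> ideal_gen V G"
  using assms
  by (induction X rule: infinite_finite_induct) (auto intro: ideal_gen_zero ideal_gen_add)

lemma ideal_gen_mult:
  assumes "p \<in> poly_ring V" "a \<in> ideal_gen V G"
  shows "p * a \<in> ideal_gen V G"
proof -
  obtain T h where T: "a = (\<Sum>g\<in>T. h g * g)" "T \<subseteq> G" "\<forall>g\<in>T. h g \<in> poly_ring V"
    using assms(2) by (auto simp: ideal_gen_def)
  have "p * a = (\<Sum>g\<in>T. (p * h g) * g)"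
    unfolding T(1) by (simp add: sum_distrib_left mult.assoc)
  then show ?thesis
    using T assms(1) by (auto intro!: ideal_gen_sum ideal_gen_mult_generator poly_ring_mult)
qed

section \<open>Avoidance polynomials\<close>

definition avoid :: "nat set \<Rightarrow> rpoly" where
  "avoid K = (\<Prod>k\<in>K. 1 - var k)"

lemma avoid_insert:
  assumes "finite K" "k \<notin> K"
  shows "avoid (insert k K) = avoid K - var k * avoid K"
  using assms by (simp add: avoid_def left_diff_distrib)

lemma vars_avoid: "vars (avoid K) \<subseteq> K"
proof (induction K rule: infinite_finite_induct)
  case (insert k K)
  then show ?case
    using vars_diff[of "avoid K" "var k * avoid K"] vars_mult[of "var k" "avoid K"]
    by (auto simp: avoid_insert)
qed (simp_all add: avoid_def)

lemma multilinear_avoid: "multilinear (avoid K)"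
proof (induction K rule: infinite_finite_induct)
  case (insert k K)
  then show ?case
    using vars_avoid[of K]
    by (auto simp: avoid_insert intro!: multilinear_diff multilinear_var_mult)
qed (simp_all add: avoid_def multilinear_one)

lemma total_degree_avoid: "total_degree (avoid K) \<le> card K"
proof (induction K rule: infinite_finite_induct)
  case (insert k K)
  have "total_degree (1 - var k) \<le> 1"
    using keys_diff[of 1 "var k"]
    by (auto simp: total_degree_le_iff var_def monom_degree_def)
  then show ?case
    using insert total_degree_mult_le[of "1 - var k" 1 "avoid K" "card K"]
    by (simp add: avoid_def)
qed (simp_all add: avoid_def total_degree_def monom_degree_def)

lemma eval_avoid_indicator:
  assumes "finite K"
  shows "eval_poly (avoid K) (indicator S) = of_bool (K \<inter> S = {})"
  using assms
proof (induction K)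
  case empty
  then show ?case by (simp add: avoid_def)
next
  case (insert k K)
  then show ?case
    by (simp add: avoid_insert eval_poly_diff eval_poly_var_mult indicator_def)
qed

text \<open>
  The polynomial is affine in \<open>x\<^sub>i\<close>: for \<open>i \<in> K\<close> it equals \<open>P - x\<^sub>i P\<close>, where the product \<open>P\<close> of
  the other factors is free of \<open>x\<^sub>i\<close>.
\<close>

lemma partial_deriv_avoid:
  assumes "finite K"
  shows "partial_deriv i (avoid K) = (if i \<in> K then - avoid (K - {i}) else 0)"
proof (cases "i \<in> K")
  case True
  let ?K = "K - {i}"
  have notin: "i \<notin> vars (avoid ?K)"
    using vars_avoid[of ?K] by blast
  have "avoid K = avoid ?K - var i * avoid ?K"
    using avoid_insert[of ?K i] assms True by (simp add: insert_absorb)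
  then show ?thesis
    using True notin
    by (simp add: partial_deriv_diff partial_deriv_notin_vars partial_deriv_var_mult)
next
  case False
  then show ?thesis
    using vars_avoid[of K] by (auto intro: partial_deriv_notin_vars)
qed

text \<open>
  For a single factor, \<open>(1 - x)\<^sup>2 - (1 - x) = x\<^sup>2 - x\<close> is a generator. Idempotence passes to
  products because \<open>(a b)\<^sup>2 - a b = a\<^sup>2 (b\<^sup>2 - b) + b (a\<^sup>2 - a)\<close>.
\<close>

lemma avoid_idempotent_mod_I2:
  assumes "K \<subseteq> V"
  shows "(avoid K)\<^sup>2 - avoid K \<in> I2 V"
  using assms
proof (induction K rule: infinite_finite_induct)
  case (insert k K)
  let ?a = "1 - var k" and ?b = "avoid K"
  have a: "?a \<in> poly_ring V" and b: "?b \<in> poly_ring V"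
    using insert.prems vars_diff[of 1 "var k"] vars_avoid[of K] by (auto simp: poly_ring_def)
  have "(avoid (insert k K))\<^sup>2 - avoid (insert k K) =
      (?a * ?a) * (?b\<^sup>2 - ?b) + ?b * ((var k)\<^sup>2 - var k)"
    using insert.hyps by (simp add: avoid_def power2_eq_square algebra_simps)
  moreover have "(?a * ?a) * (?b\<^sup>2 - ?b) \<in> I2 V"
    using insert a unfolding I2_def by (auto intro!: ideal_gen_mult poly_ring_mult)
  moreover have "?b * ((var k)\<^sup>2 - var k) \<in> I2 V"
    using insert.prems b unfolding I2_def by (auto intro!: ideal_gen_mult_generator)
  ultimately show ?case unfolding I2_def by (simp add: ideal_gen_add)
qed (simp_all add: avoid_def I2_def ideal_gen_zero)

section \<open>Coverage functions\<close>

text \<open>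
  By uniqueness of the multilinear extension it suffices to compare values on the cube, where
  \<open>1 - avoid K\<^sub>l\<close> indicates that some set chosen by \<open>S\<close> contains \<open>l\<close>; summing these indicators
  over \<open>U\<close> counts the covered elements.
\<close>

lemma mle_coverage:
  fixes A :: "nat \<Rightarrow> nat set"
  assumes "finite U" and A: "\<And>k. k \<in> {1..n} \<Longrightarrow> A k \<subseteq> U"
  shows "mle n (coverage A) = (\<Sum>l\<in>U. 1 - avoid {k \<in> {1..n}. l \<in> A k})"
proof -
  let ?K = "\<lambda>l. {k \<in> {1..n}. l \<in> A k}"
  let ?F = "\<Sum>l\<in>U. 1 - avoid (?K l)"
  have "vars (1 - avoid (?K l)) \<subseteq> {1..n}" for l
    using vars_diff[of 1 "avoid (?K l)"] vars_avoid[of "?K l"] by auto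
  then have "?F \<in> poly_ring {1..n}"
    using vars_sum[of "\<lambda>l. 1 - avoid (?K l)" U] by (fastforce simp: poly_ring_def)
  moreover have "multilinear ?F"
    by (intro multilinear_sum multilinear_diff multilinear_one multilinear_avoid)
  moreover have "eval_poly ?F (indicator S) = coverage A S" if S: "S \<subseteq> {1..n}" for S
  proof -
    have "eval_poly ?F (indicator S) = (\<Sum>l\<in>U. of_bool (l \<in> (\<Union>i\<in>S. A i)))"
      unfolding eval_poly_sum eval_poly_diff
    proof (rule sum.cong)
      fix l
      have "?K l \<inter> S = {} \<longleftrightarrow> l \<notin> (\<Union>i\<in>S. A i)"
        using S by blast
      moreover have "finite (?K l)" by simp
      ultimately show "eval_poly 1 (indicator S) - eval_poly (avoid (?K l)) (indicator S) =
          of_bool (l \<in> (\<Union>i\<in>S. A i))"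
        by (simp only: eval_avoid_indicator eval_poly_one) simp
    qed simp
    also have "\<dots> = real (card (U \<inter> (\<Union>i\<in>S. A i)))"
      using \<open>finite U\<close> by (subst sum_of_bool_eq) (simp_all add: Int_def)
    also have "U \<inter> (\<Union>i\<in>S. A i) = (\<Union>i\<in>S. A i)"
      using S A by blast
    finally show ?thesis by (simp add: coverage_def)
  qed
  ultimately have "is_mle n (coverage A) ?F"
    by (simp add: is_mle_def)
  then show ?thesis
    using ex1_mle is_mle_mle by blast
qed

theorem proposition12:
  fixes m n t :: nat and A :: "nat \<Rightarrow> nat set"
  assumes "\<And>k. k \<in> {1..n} \<Longrightarrow> A k \<subseteq> {1..m}"
    and "t = Max ((\<lambda>l. card {k \<in> {1..n}. l \<in> A k}) ` {1..m})"
    and "t \<ge> 2"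
  shows "sos_submodular n (t - 2) (coverage A)"
  unfolding sos_submodular_def
proof (intro ballI impI)
  fix i j assume "i \<in> {1..n}" "j \<in> {1..n}" "i \<noteq> j"
  define K where "K l = {k \<in> {1..n}. l \<in> A k}" for l
  let ?V = "{1..n} - {i, j}"
  \<comment> \<open>Padding by \<open>0\<close> keeps the squares indexed by all of \<open>{1..m}\<close>.\<close>
  define q where "q l = (if i \<in> K l \<and> j \<in> K l then avoid (K l - {i, j}) else 0)" for l
  have fin: "finite (K l)" for l by (simp add: K_def)
  have "- partial_deriv i (partial_deriv j (1 - avoid (K l))) = q l" for l
  proof -
    have "partial_deriv j (1 - avoid (K l)) = (if j \<in> K l then avoid (K l - {j}) else 0)"
      using fin by (simp add: partial_deriv_diff partial_deriv_avoid partial_deriv_notin_vars)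
    moreover have "K l - {j} - {i} = K l - {i, j}" by blast
    ultimately show ?thesis
      using fin \<open>i \<noteq> j\<close> by (simp add: partial_deriv_avoid q_def)
  qed
  then have deriv: "- partial_deriv i (partial_deriv j (mle n (coverage A))) = (\<Sum>l=1..m. q l)"
    using mle_coverage[of "{1..m}" n A] assms(1)
    by (simp add: partial_deriv_sum K_def flip: sum_negf)
  have ring: "q l \<in> poly_ring ?V" for l
    using vars_avoid[of "K l - {i, j}"] by (auto simp: q_def poly_ring_def vars_def K_def)
  have deg: "total_degree (q l) \<le> t - 2" if "l \<in> {1..m}" for l
  proof (cases "i \<in> K l \<and> j \<in> K l")
    case True
    have "card (K l) \<le> t"
      using that unfolding assms(2) K_def by (intro Max_ge) auto
    moreover have "card (K l - {i, j}) = card (K l) - 2"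
      using True \<open>i \<noteq> j\<close> by (simp add: card_Diff_subset)
    ultimately show ?thesis
      using total_degree_avoid[of "K l - {i, j}"] True by (simp add: q_def)
  qed (auto simp: q_def total_degree_def)
  have idem: "q l - (q l)\<^sup>2 \<in> I2 ?V" for l
  proof -
    have "(q l)\<^sup>2 - q l \<in> I2 ?V"
    proof (cases "i \<in> K l \<and> j \<in> K l")
      case True
      have "K l - {i, j} \<subseteq> ?V" by (auto simp: K_def)
      then show ?thesis
        using True by (simp add: q_def avoid_idempotent_mod_I2)
    next
      case False
      then have "q l = 0" by (auto simp: q_def)
      then show ?thesis by (simp add: I2_def ideal_gen_zero)
    qed
    moreover have "- 1 \<in> poly_ring ?V" by (simp add: poly_ring_def vars_def)
    ultimately have "(- 1) * ((q l)\<^sup>2 - q l) \<in> I2 ?V"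
      unfolding I2_def by (intro ideal_gen_mult)
    then show ?thesis by simp
  qed
  have "(\<Sum>l=1..m. q l) - (\<Sum>l=1..m. (q l)\<^sup>2) = (\<Sum>l=1..m. q l - (q l)\<^sup>2)"
    by (simp add: sum_subtractf)
  also have "\<dots> \<in> I2 ?V"
    using idem unfolding I2_def by (intro ideal_gen_sum)
  finally show "sos_mod ?V (t - 2) (I2 ?V)
      (- partial_deriv i (partial_deriv j (mle n (coverage A))))"
    unfolding sos_mod_def deriv using ring deg by blast
qed

end
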